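(* Let $G$ be a graph of order $n$ with minimum degree $\delta(G) \ge 4$. Then $\gamma_{\rm pr}(G) \le \frac{10}{17}n$ (in particular $\gamma_{\rm pr}(G) < 0.5883\, n$).
   Context: All graphs are finite and simple. A set $S \subseteq V(G)$ is a paired dominating set of $G$ if every vertex of $G$ not in $S$ is adjacent to a vertex in $S$ and the induced subgraph $G[S]$ contains a perfect matching (not necessarily induced). The paired domination number $\gamma_{\rm pr}(G)$ is the minimum cardinality of a paired dominating set of $G$. *)

theory Defs
  imports Complex_Main
begin

definition simple_graph :: "'a set \<Rightarrow> ('a \<Rightarrow> 'a \<Rightarrow> bool) \<Rightarrow> bool" where
  "simple_graph V E \<longleftrightarrow> finite V \<and> (\<forall>u v. E u v \<longrightarrow> u \<in> V \<and> v \<in> V)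
     \<and> (\<forall>u v. E u v \<longrightarrow> E v u) \<and> (\<forall>v. \<not> E v v)"

definition degree :: "'a set \<Rightarrow> ('a \<Rightarrow> 'a \<Rightarrow> bool) \<Rightarrow> 'a \<Rightarrow> nat" where
  "degree V E v = card {u \<in> V. E v u}"

definition dominating :: "'a set \<Rightarrow> ('a \<Rightarrow> 'a \<Rightarrow> bool) \<Rightarrow> 'a set \<Rightarrow> bool" where
  "dominating V E S \<longleftrightarrow> S \<subseteq> V \<and> (\<forall>v \<in> V - S. \<exists>u \<in> S. E v u)"

definition perfect_matching_of :: "('a \<Rightarrow> 'a \<Rightarrow> bool) \<Rightarrow> 'a set \<Rightarrow> 'a set set \<Rightarrow> bool" where
  "perfect_matching_of E S M \<longleftrightarrow>
     (\<forall>e \<in> M. \<exists>u v. e = {u, v} \<and> E u v \<and> u \<in> S \<and> v \<in> S)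
     \<and> (\<forall>e1 \<in> M. \<forall>e2 \<in> M. e1 \<noteq> e2 \<longrightarrow> e1 \<inter> e2 = {})
     \<and> (\<forall>v \<in> S. \<exists>e \<in> M. v \<in> e)"

definition paired_dominating :: "'a set \<Rightarrow> ('a \<Rightarrow> 'a \<Rightarrow> bool) \<Rightarrow> 'a set \<Rightarrow> bool" where
  "paired_dominating V E S \<longleftrightarrow> dominating V E S \<and> (\<exists>M. perfect_matching_of E S M)"

definition gamma_pr :: "'a set \<Rightarrow> ('a \<Rightarrow> 'a \<Rightarrow> bool) \<Rightarrow> nat" where
  "gamma_pr V E = Min (card ` {S. paired_dominating V E S})"

end

theory Submission
  imports Defs
begin

text \<open>
  A greedy weighting argument. Grow a set S by matched pairs; call a vertex white if it is neither
  in S nor dominated by S, and blue if it is dominated but not in S. A white vertex has weight 70, a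
  blue vertex with i white neighbours has weight 0, 42, 50, 53 or 56 for i = 0, 1, 2, 3 or more.
  As long as there are white vertices, some edge that avoids S and has a white end can be added to S
  so that the total weight drops by at least 238. The initial weight is 70n, so at most 70n/238
  pairs are used, that is 10n/17 vertices.

  If no edge gives such a drop, then one bounds successively the number of white neighbours of
  white and of blue vertices; each bound steepens the slope of the blue weights that are still in
  play (0, then 3, 8 and 42), until no white vertex is left. The usual candidate is an edge vx, for
  fixed v, whose end x has the most white neighbours outside the closed neighbourhood of v: that
  number also bounds the remaining white degree of every other white neighbour of v.
\<close>

section \<open>Weights of blue vertices and their increments\<close>

text \<open>
  The values 42 and 50 are forced by white vertices without white neighbours whose blue
  neighbours have one or two white neighbours each: 70 + 4 * 42 = 238 and 50 + 2 * 70 + 6 * 8 = 238.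
\<close>

definition bw :: "nat \<Rightarrow> int" where
  "bw n = (if n = 0 then 0 else if n = 1 then 42 else if n = 2 then 50 else if n = 3 then 53 else 56)"

lemma bw_nonneg: "0 \<le> bw n"
  by (simp add: bw_def)

lemma bw_mono: "m \<le> n \<Longrightarrow> bw m \<le> bw n"
  by (auto simp: bw_def)

lemma bw_simps: "bw 0 = 0" "bw 1 = 42" "bw (Suc 0) = 42" "bw 2 = 50" "bw 3 = 53" "4 \<le> n \<Longrightarrow> bw n = 56"
  by (auto simp: bw_def)

text \<open>The increments of \<open>bw\<close> are 42, 8, 3, 3 and then 0, so the last increment in
  range is the worst one: while blue vertices have at most 4, 2 or 1 white neighbours, each lost one
  is worth at least 3, 8 or 42.\<close>

lemma bw_slope3: "n \<le> 4 \<Longrightarrow> m \<le> n \<Longrightarrow> 3 * int m \<le> bw n - bw (n - m)"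
proof -
  assume "n \<le> 4" "m \<le> n"
  then have "n \<in> {0,1,2,3,4}" "m \<in> {0,1,2,3,4}" by auto
  with \<open>m \<le> n\<close> show ?thesis by (elim insertE emptyE; simp add: bw_def)
qed

lemma bw_slope8: "n \<le> 2 \<Longrightarrow> m \<le> n \<Longrightarrow> 8 * int m \<le> bw n - bw (n - m)"
proof -
  assume "n \<le> 2" "m \<le> n"
  then have "n \<in> {0,1,2}" "m \<in> {0,1,2}" by auto
  with \<open>m \<le> n\<close> show ?thesis by (elim insertE emptyE; simp add: bw_def)
qed

lemma bw_slope42: "n \<le> 1 \<Longrightarrow> m \<le> n \<Longrightarrow> 42 * int m \<le> bw n - bw (n - m)"
proof -
  assume "n \<le> 1" "m \<le> n"
  then have "n \<in> {0,1}" "m \<in> {0,1}" by auto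
  with \<open>m \<le> n\<close> show ?thesis by (elim insertE emptyE; simp add: bw_def)
qed

definition pot :: "('a \<Rightarrow> 'a \<Rightarrow> bool) \<Rightarrow> 'a set \<Rightarrow> 'a set \<Rightarrow> int" where
  "pot E W B = 70 * int (card W) + (\<Sum>u\<in>B. bw (card {w \<in> W. E u w}))"

lemma pot_nonneg: "0 \<le> pot E W B"
  by (simp add: pot_def bw_nonneg sum_nonneg)

section \<open>Auxiliary sums and counting\<close>

lemma card_remove_int:
  "finite A \<Longrightarrow> a \<in> A \<Longrightarrow> int (card (A - {a})) = int (card A) - 1"
  using card.remove[of A a] by linarith

lemma sum_ge_const:
  fixes f :: "'b \<Rightarrow> int"
  assumes "\<And>z. z \<in> A \<Longrightarrow> c \<le> f z"
  shows "int (card A) * c \<le> sum f A"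
  using sum_bounded_below[of A c f] assms by simp

lemma sum_ge_special:
  fixes f :: "'b \<Rightarrow> int"
  assumes "finite A" "a \<in> A" "c0 \<le> f a" "\<And>z. z \<in> A \<Longrightarrow> c \<le> f z"
  shows "c0 + (int (card A) - 1) * c \<le> sum f A"
proof -
  have "sum f A = f a + sum f (A - {a})" using assms by (simp add: sum.remove)
  moreover have "int (card (A - {a})) * c \<le> sum f (A - {a})"
    by (rule sum_ge_const) (use assms in auto)
  moreover have "int (card (A - {a})) = int (card A) - 1"
    using assms by (intro card_remove_int)
  ultimately show ?thesis using assms(3) by simp
qed

text \<open>Disjoint edges cannot cover three vertices, so two of the edges share a vertex.\<close>

lemma card3_two_neighbours:
  assumes "card Z = 3" and sym: "\<And>a b. R a b \<Longrightarrow> R b a" and irr: "\<And>a. \<not> R a a"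
    and nb: "\<And>a. a \<in> Z \<Longrightarrow> \<exists>b\<in>Z. R a b"
  obtains a b c where "a \<in> Z" "b \<in> Z" "c \<in> Z" "b \<noteq> c" "R a b" "R a c"
proof -
  obtain p q r where Z: "Z = {p,q,r}" "p \<noteq> q" "q \<noteq> r" "p \<noteq> r"
    using assms(1) by (auto simp: card_3_iff)
  have "R p q \<or> R p r" "R q p \<or> R q r" "R r p \<or> R r q"
    using nb[of p] nb[of q] nb[of r] irr Z by auto
  then have "(R p q \<and> R p r) \<or> (R q p \<and> R q r) \<or> (R r p \<and> R r q)" using sym by blast
  then show thesis using that Z by blast
qed

section \<open>White and blue vertices, and the weight drop of an edge\<close>

text \<open>The degree condition concerns white vertices: having no neighbour among the chosen
  vertices, they keep all their edges inside \<open>W \<union> B\<close>.\<close>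

locale coloured_graph =
  fixes W B :: "'a set" and E :: "'a \<Rightarrow> 'a \<Rightarrow> bool"
  assumes finW: "finite W" and finB: "finite B" and disj: "W \<inter> B = {}"
    and sym: "E a b \<Longrightarrow> E b a" and irrefl: "\<not> E a a"
    and deg: "x \<in> W \<Longrightarrow> 4 \<le> card {y \<in> W \<union> B. E x y}"
begin

definition N :: "'a \<Rightarrow> 'a set" where "N v = {w \<in> W. E v w}"

definition d :: "'a \<Rightarrow> nat" where "d v = card (N v)"

definition e :: "'a \<Rightarrow> nat" where "e x = card {v \<in> B. E x v}"

text \<open>
  If v x is an edge with x white, then \<open>cov v x\<close> is the set of white vertices that adding v and x
  dominates (v included if it is white, being a neighbour of x), \<open>dp v x z\<close> is the number of white
  neighbours that z keeps, and \<open>gain v x\<close> is the drop of the weight.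
\<close>

definition cov :: "'a \<Rightarrow> 'a \<Rightarrow> 'a set" where "cov v x = N v \<union> N x"

definition dp :: "'a \<Rightarrow> 'a \<Rightarrow> 'a \<Rightarrow> nat" where "dp v x z = card (N z - cov v x)"

definition out :: "'a \<Rightarrow> 'a \<Rightarrow> 'a set" where "out v x = N x - N v - {v}"

text \<open>The drop of a white vertex that turns blue and keeps \<open>n\<close> white
  neighbours.\<close>

definition g :: "nat \<Rightarrow> int" where "g n = 70 - bw n"

definition gain :: "'a \<Rightarrow> 'a \<Rightarrow> int" where
  "gain v x = pot E W B - pot E (W - cov v x) (B \<union> cov v x - {v, x})"

lemma g_simps: "g 0 = 70" "g 1 = 28" "g (Suc 0) = 28" "g 2 = 20" "g 3 = 17" "4 \<le> n \<Longrightarrow> g n = 14"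
  by (auto simp: g_def bw_simps)

lemma g_anti: "m \<le> n \<Longrightarrow> g n \<le> g m"
  by (simp add: g_def bw_mono)

lemma g_ge14: "14 \<le> g n"
  by (simp add: g_def bw_def)

lemma N_subset: "N v \<subseteq> W" by (auto simp: N_def)

lemma finN [simp]: "finite (N v)"
  using finW N_subset finite_subset by blast

lemma N_sym: "x \<in> N v \<Longrightarrow> v \<in> W \<Longrightarrow> v \<in> N x"
  by (auto simp: N_def sym)

lemma self_notin_N [simp]: "v \<notin> N v"
  by (auto simp: N_def irrefl)

lemma fincov [simp]: "finite (cov v x)" by (simp add: cov_def)

lemma finout [simp]: "finite (out v x)" by (simp add: out_def)

lemma d_e: "x \<in> W \<Longrightarrow> 4 \<le> d x + e x"
proof -
  assume "x \<in> W"
  have "{y \<in> W \<union> B. E x y} = N x \<union> {v \<in> B. E x v}" by (auto simp: N_def)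
  then have "card {y \<in> W \<union> B. E x y} \<le> d x + e x"
    unfolding d_def e_def by (simp add: card_Un_le)
  then show ?thesis using deg[OF \<open>x \<in> W\<close>] by simp
qed

lemma cov_split:
  assumes "x \<in> N v"
  shows "cov v x - {v, x} = (N v - {x}) \<union> out v x" "(N v - {x}) \<inter> out v x = {}"
  using assms by (auto simp: cov_def out_def)

text \<open>Neighbours of \<open>v\<close> become dominated, and so does a white \<open>v\<close>,
  through \<open>x\<close>; a blue \<open>v\<close> does not count. Hence an \<open>x\<close> with
  \<open>out v x\<close> largest controls \<open>dp v x z\<close> for all white neighbours
  \<open>z\<close> of \<open>v\<close> at once.\<close>

lemma dp_le_out: "dp v x z \<le> card (out v z)" if "x \<in> N v" "v \<in> W \<union> B"
proof -
  have "N z - cov v x \<subseteq> out v z"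
    using that N_sym[of x v] N_subset[of z] disj by (auto simp: cov_def out_def)
  then show ?thesis unfolding dp_def by (simp add: card_mono)
qed

lemma dp_less: "dp v x y < d y" if "w \<in> N y" "w \<in> cov v x"
  unfolding dp_def d_def using that by (intro psubset_card_mono) auto

text \<open>\<open>y\<close> loses at least its neighbour \<open>x\<close>.\<close>

lemma dp_out_less: "dp v x y < d y" if "x \<in> N v" "y \<in> out v x"
proof (rule dp_less)
  show "x \<in> cov v x" using that by (simp add: cov_def)
  show "x \<in> N y" using that N_subset by (auto simp: out_def intro: N_sym)
qed

text \<open>The drop has three sources: the two chosen ends, the white vertices that turn blue, and
  the old blue vertices that lose white neighbours.\<close>

lemma gain_eq:
  assumes v: "v \<in> W \<union> B" and x: "x \<in> N v"
  shows "gain v x = (if v \<in> W then 140 else bw (d v) + 70)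
    + (\<Sum>z\<in>cov v x - {v, x}. g (dp v x z)) + (\<Sum>w\<in>B - {v}. bw (d w) - bw (dp v x w))"
proof -
  let ?C = "cov v x"
  have CW: "?C \<subseteq> W" using N_subset by (auto simp: cov_def)
  have xW: "x \<in> W" "x \<in> ?C" "x \<noteq> v" using x N_subset by (auto simp: cov_def)
  have sets: "{w \<in> W - ?C. E u w} = N u - ?C" for u by (auto simp: N_def)
  have B': "B \<union> ?C - {v, x} = (B - {v}) \<union> (?C - {v, x})" using xW disj by auto
  have d: "(B - {v}) \<inter> (?C - {v, x}) = {}" using CW disj by auto
  have new: "pot E (W - ?C) (B \<union> ?C - {v, x}) = 70 * int (card (W - ?C))
     + ((\<Sum>w\<in>B - {v}. bw (dp v x w)) + (\<Sum>w\<in>?C - {v,x}. bw (dp v x w)))"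
    unfolding pot_def sets B' dp_def using finB d by (subst sum.union_disjoint) auto
  have old: "pot E W B = 70 * int (card W) + (\<Sum>w\<in>B. bw (d w))"
    by (simp add: pot_def d_def N_def)
  have cW: "int (card (W - ?C)) = int (card W) - int (card ?C)"
    using CW finW by (simp add: card_Diff_subset card_mono of_nat_diff)
  have sg: "(\<Sum>z\<in>?C - {v, x}. g (dp v x z)) = 70 * int (card (?C - {v,x})) - (\<Sum>w\<in>?C - {v,x}. bw (dp v x w))"
    by (simp add: g_def sum_subtractf)
  show ?thesis
  proof (cases "v \<in> W")
    case True
    then have vB: "v \<notin> B" and "v \<in> ?C" using disj N_sym[OF x] by (auto simp: cov_def)
    then have "?C = insert v (insert x (?C - {v,x}))" using xW by auto
    then have "card ?C = card (insert v (insert x (?C - {v,x})))" by (rule arg_cong)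
    then have "int (card ?C) = 2 + int (card (?C - {v,x}))" using xW by simp
    then show ?thesis using True vB unfolding gain_def new old cW sg by (simp add: sum_subtractf)
  next
    case False
    then have vB: "v \<in> B" and "v \<notin> ?C" using v CW by auto
    then have "?C = insert x (?C - {v,x})" using xW by auto
    then have "card ?C = card (insert x (?C - {v,x}))" by (rule arg_cong)
    then have "int (card ?C) = 1 + int (card (?C - {v,x}))" by simp
    moreover have "(\<Sum>w\<in>B. bw (d w)) = bw (d v) + (\<Sum>w\<in>B - {v}. bw (d w))"
      using vB finB by (simp add: sum.remove)
    ultimately show ?thesis using False unfolding gain_def new old cW sg by (simp add: sum_subtractf)
  qed
qed

text \<open>\<open>s\<close> is a guaranteed drop of the other blue vertices per lost white
  neighbour. The values used are 0, 3, 8, 21 and 42.\<close>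

definition slope :: "int \<Rightarrow> 'a \<Rightarrow> 'a \<Rightarrow> bool" where
  "slope s v x \<longleftrightarrow> (\<forall>w\<in>B - {v}. s * int (card (N w \<inter> cov v x)) \<le> bw (d w) - bw (dp v x w))"

lemma dp_eq: "dp v x w = d w - card (N w \<inter> cov v x)"
  unfolding dp_def d_def by (simp add: card_Diff_subset_Int)

lemma inter_le: "card (N w \<inter> cov v x) \<le> d w"
  unfolding d_def by (simp add: card_mono)

lemma slope0: "slope 0 v x"
  unfolding slope_def by (auto simp: dp_eq intro: bw_mono)

text \<open>Double counting of the edges between \<open>cov v x\<close> and \<open>B - {v}\<close>.
  It credits the drop of the old blue vertices to the newly dominated white ones.\<close>

lemma drop_ge:
  assumes "slope s v x"
  shows "s * (\<Sum>z\<in>cov v x. int (card {w \<in> B - {v}. E z w}))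
    \<le> (\<Sum>w\<in>B - {v}. bw (d w) - bw (dp v x w))"
proof -
  let ?C = "cov v x"
  have card_ind: "int (card {a \<in> A. P a}) = (\<Sum>a\<in>A. if P a then 1 else 0)" if "finite A"
    for A :: "'a set" and P using that by (simp add: sum.If_cases Int_def)
  have CW: "?C \<subseteq> W" using N_subset by (auto simp: cov_def)
  have "N w \<inter> ?C = {z \<in> ?C. E z w}" for w using CW sym by (auto simp: N_def)
  then have "(\<Sum>w\<in>B - {v}. int (card (N w \<inter> ?C))) = (\<Sum>w\<in>B - {v}. \<Sum>z\<in>?C. if E z w then 1 else 0)"
    by (simp only: card_ind fincov)
  also have "\<dots> = (\<Sum>z\<in>?C. \<Sum>w\<in>B - {v}. if E z w then 1 else 0)"
    by (rule sum.swap)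
  also have "\<dots> = (\<Sum>z\<in>?C. int (card {w \<in> B - {v}. E z w}))"
    using finB by (simp only: card_ind finite_Diff)
  finally have "s * (\<Sum>z\<in>?C. int (card {w \<in> B - {v}. E z w}))
      = (\<Sum>w\<in>B - {v}. s * int (card (N w \<inter> ?C)))" by (simp only: sum_distrib_left[symmetric])
  also have "\<dots> \<le> (\<Sum>w\<in>B - {v}. bw (d w) - bw (dp v x w))"
    by (rule sum_mono) (use assms in \<open>auto simp: slope_def\<close>)
  finally show ?thesis .
qed

text \<open>The dominated vertices other than the ends form two layers, bounded by \<open>a\<close>
  and \<open>b\<close>: the neighbours of \<open>v\<close>, and those reached only through
  \<open>x\<close>. Each brings its own drop and a credit of \<open>s\<close> per blue
  neighbour.\<close>

lemma gain_white:
  assumes v: "v \<in> W" and x: "x \<in> N v" and s: "slope s v x"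
    and Z: "a \<le> (\<Sum>z\<in>N v - {x}. g (dp v x z) + s * int (e z))"
    and Y: "b \<le> (\<Sum>y\<in>out v x. g (dp v x y) + s * int (e y))"
  shows "140 + s * int (e v) + s * int (e x) + a + b \<le> gain v x"
proof -
  let ?C = "cov v x"
  have B: "B - {v} = B" using v disj by auto
  have C: "?C = insert v (insert x (?C - {v,x}))" using v x N_sym by (auto simp: cov_def)
  have "x \<noteq> v" using x by auto
  have "(\<Sum>z\<in>?C. int (e z)) = int (e v) + int (e x) + (\<Sum>z\<in>?C - {v,x}. int (e z))"
    by (subst C) (use \<open>x \<noteq> v\<close> in simp)
  then have dr: "s * int (e v) + s * int (e x) + (\<Sum>z\<in>?C - {v,x}. s * int (e z)) \<le> (\<Sum>w\<in>B - {v}. bw (d w) - bw (dp v x w))"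
    using drop_ge[OF s] unfolding B e_def by (simp add: algebra_simps sum_distrib_left)
  have "a + b \<le> (\<Sum>z\<in>?C - {v,x}. g (dp v x z) + s * int (e z))"
    using Z Y cov_split[OF x] by (simp add: sum.union_disjoint)
  then show ?thesis using gain_eq[OF _ x] v dr by (simp add: sum.distrib)
qed

text \<open>The chosen blue vertex \<open>v\<close> yields no credit, whence the \<open>- 1\<close>
  for its neighbours; the vertices of \<open>out v x\<close> are not adjacent to \<open>v\<close>
  and keep the full credit.\<close>

lemma gain_blue:
  assumes v: "v \<in> B" and x: "x \<in> N v" and s: "slope s v x"
    and Z: "a \<le> (\<Sum>z\<in>N v - {x}. g (dp v x z) + s * (int (e z) - 1))"
    and Y: "b \<le> (\<Sum>y\<in>out v x. g (dp v x y) + s * int (e y))"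
  shows "bw (d v) + 70 + s * (int (e x) - 1) + a + b \<le> gain v x"
proof -
  let ?C = "cov v x" and ?e = "\<lambda>z. int (card {w \<in> B - {v}. E z w})"
  have vW: "v \<notin> W" using v disj by auto
  have C: "?C = insert x (?C - {v,x})" using v x vW N_subset by (auto simp: cov_def)
  have e1: "?e z = int (e z) - 1" if "z \<in> N v" for z
  proof -
    have "v \<in> {w \<in> B. E z w}" using that v sym by (auto simp: N_def)
    moreover have "{w \<in> B - {v}. E z w} = {w \<in> B. E z w} - {v}" by auto
    moreover have "finite {w \<in> B. E z w}" using finB by simp
    ultimately show ?thesis unfolding e_def by (metis card_remove_int)
  qed
  have e2: "?e y = int (e y)" if "y \<in> out v x" for y
  proof -
    have "\<not> E y v" using that sym N_subset by (auto simp: out_def N_def)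
    then have "{w \<in> B - {v}. E y w} = {w \<in> B. E y w}" by auto
    then show ?thesis by (simp add: e_def)
  qed
  have "(\<Sum>z\<in>?C. ?e z) = ?e x + (\<Sum>z\<in>?C - {v,x}. ?e z)"
    by (subst C) simp
  then have dr: "s * (int (e x) - 1) + (\<Sum>z\<in>?C - {v,x}. s * ?e z) \<le> (\<Sum>w\<in>B - {v}. bw (d w) - bw (dp v x w))"
    using drop_ge[OF s] e1[OF x] by (simp only: distrib_left sum_distrib_left)
  have "(\<Sum>z\<in>N v - {x}. g (dp v x z) + s * ?e z) = (\<Sum>z\<in>N v - {x}. g (dp v x z) + s * (int (e z) - 1))"
    by (rule sum.cong) (use e1 in auto)
  moreover have "(\<Sum>y\<in>out v x. g (dp v x y) + s * ?e y) = (\<Sum>y\<in>out v x. g (dp v x y) + s * int (e y))"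
    by (rule sum.cong) (use e2 in auto)
  ultimately have "a + b \<le> (\<Sum>z\<in>?C - {v,x}. g (dp v x z) + s * ?e z)"
    using Z Y cov_split[OF x] by (simp add: sum.union_disjoint)
  then show ?thesis using gain_eq[OF _ x] v vW dr by (simp add: sum.distrib)
qed

lemma max_out:
  assumes "N v \<noteq> {}"
  obtains x where "x \<in> N v" "\<And>z. z \<in> N v \<Longrightarrow> card (out v z) \<le> card (out v x)"
proof -
  have "Max ((\<lambda>z. card (out v z)) ` N v) \<in> (\<lambda>z. card (out v z)) ` N v"
    using assms by (intro Max_in) auto
  then obtain x where "x \<in> N v" "Max ((\<lambda>z. card (out v z)) ` N v) = card (out v x)" by auto
  then show thesis using that by (metis Max_ge finN finite_imageI imageI)
qed

lemma card_N_minus: "x \<in> N v \<Longrightarrow> int (card (N v - {x})) = int (d v) - 1"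
  unfolding d_def by (rule card_remove_int) auto

lemma g_ge: "n \<le> 0 \<Longrightarrow> 70 \<le> g n" "n \<le> 1 \<Longrightarrow> 28 \<le> g n" "n \<le> 2 \<Longrightarrow> 20 \<le> g n" "n \<le> 3 \<Longrightarrow> 17 \<le> g n"
  using g_anti[of n 1] g_anti[of n 2] g_anti[of n 3] by (auto simp: g_simps)

lemma gain_white_const:
  assumes "v \<in> W" "x \<in> N v" "slope s v x"
    and Z: "\<And>z. z \<in> N v \<Longrightarrow> a \<le> g (dp v x z) + s * int (e z)"
    and Y: "\<And>y. y \<in> out v x \<Longrightarrow> b \<le> g (dp v x y) + s * int (e y)"
  shows "140 + s * int (e v) + s * int (e x) + (int (d v) - 1) * a + int (card (out v x)) * b \<le> gain v x"
proof -
  have "int (card (N v - {x})) * a \<le> (\<Sum>z\<in>N v - {x}. g (dp v x z) + s * int (e z))"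
    by (rule sum_ge_const) (simp add: Z)
  moreover have "int (card (out v x)) * b \<le> (\<Sum>y\<in>out v x. g (dp v x y) + s * int (e y))"
    by (rule sum_ge_const) (rule Y)
  ultimately show ?thesis
    using gain_white[OF assms(1-3)] unfolding card_N_minus[OF assms(2)] by blast
qed

lemma gain_blue_const:
  assumes "v \<in> B" "x \<in> N v" "slope s v x"
    and Z: "\<And>z. z \<in> N v \<Longrightarrow> a \<le> g (dp v x z) + s * (int (e z) - 1)"
    and Y: "\<And>y. y \<in> out v x \<Longrightarrow> b \<le> g (dp v x y) + s * int (e y)"
  shows "bw (d v) + 70 + s * (int (e x) - 1) + (int (d v) - 1) * a + int (card (out v x)) * b \<le> gain v x"
proof -
  have "int (card (N v - {x})) * a \<le> (\<Sum>z\<in>N v - {x}. g (dp v x z) + s * (int (e z) - 1))"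
    by (rule sum_ge_const) (simp add: Z)
  moreover have "int (card (out v x)) * b \<le> (\<Sum>y\<in>out v x. g (dp v x y) + s * int (e y))"
    by (rule sum_ge_const) (rule Y)
  ultimately show ?thesis
    using gain_blue[OF assms(1-3)] unfolding card_N_minus[OF assms(2)] by blast
qed

lemma in_N_W: "x \<in> N v \<Longrightarrow> x \<in> W" using N_subset by auto

lemma out_W: "y \<in> out v x \<Longrightarrow> y \<in> W" using N_subset by (auto simp: out_def)

lemma card_out_less: "x \<in> N u \<Longrightarrow> u \<in> W \<Longrightarrow> card (out u x) < d x"
  unfolding d_def using N_sym[of x u] by (intro psubset_card_mono) (auto simp: out_def)

lemma card_out_le: "card (out u x) \<le> d x"
  unfolding d_def by (intro card_mono) (auto simp: out_def)

text \<open>If \<open>y\<close> loses only one white neighbour, this is \<open>x\<close>, and then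
  \<open>x\<close> and \<open>y\<close> have no common white neighbour. Seen from \<open>y\<close>,
  all other neighbours of \<open>x\<close> are outer, which will contradict upper bounds on
  \<open>out y x\<close>.\<close>

lemma card_out_lone:
  assumes x: "x \<in> N u" and y: "y \<in> out u x" and "d y \<le> dp u x y + 1"
  shows "card (out y x) = d x - 1"
proof -
  have xy: "x \<in> N y" "y \<in> N x" using y in_N_W[OF x] by (auto simp: out_def intro: N_sym in_N_W)
  have "card (N y \<inter> cov u x) \<le> 1"
    using assms(3) inter_le[of y u x] unfolding dp_eq by linarith
  moreover have "x \<in> N y \<inter> cov u x" using xy x by (auto simp: cov_def)
  ultimately have "N y \<inter> cov u x = {x}"
    by (auto simp: card_le_Suc0_iff_eq)
  then have "N x \<inter> N y \<subseteq> {x}" by (simp add: cov_def) blast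
  then have "N x \<inter> N y = {}" using self_notin_N[of x] by blast
  then have "out y x = N x - {y}" by (auto simp: out_def)
  then show ?thesis using xy by (simp add: d_def)
qed

end

section \<open>No edge drops the weight by 238: degrees at most 4\<close>

locale stuck_graph = coloured_graph +
  assumes stuck: "v \<in> W \<union> B \<Longrightarrow> x \<in> N v \<Longrightarrow> gain v x < 238"
begin

lemma white_le_4:
  assumes u: "u \<in> W"
  shows "d u \<le> 4"
proof (rule ccontr)
  assume "\<not> d u \<le> 4"
  then have ne: "N u \<noteq> {}" by (auto simp: d_def)
  obtain x where x: "x \<in> N u" and max: "\<And>z. z \<in> N u \<Longrightarrow> card (out u z) \<le> card (out u x)"
    using max_out[OF ne] by blast
  let ?k = "card (out u x)"
  have "140 + 0 * int (e u) + 0 * int (e x) + (int (d u) - 1) * g ?k + int ?k * 14 \<le> gain u x"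
  proof (rule gain_white_const[OF u x slope0])
    show "g ?k \<le> g (dp u x z) + 0 * int (e z)" if "z \<in> N u" for z
      using dp_le_out[OF x, of z] u max[OF that] g_anti[of "dp u x z" ?k] by simp
  qed (simp add: g_ge14)
  moreover have "4 * g ?k \<le> (int (d u) - 1) * g ?k"
    using \<open>\<not> d u \<le> 4\<close> g_ge14[of ?k] by (intro mult_right_mono) auto
  \<comment> \<open>The ends bring 140, so 98 is missing. The minimum of the left side is 108, at
    \<open>?k = 2\<close>.\<close>
  moreover have "98 \<le> 4 * g ?k + int ?k * 14"
  proof -
    consider "?k = 0" | "?k = 1" | "?k = 2" | "?k = 3" | "4 \<le> ?k" by linarith
    then show ?thesis by cases (auto simp: g_simps)
  qed
  ultimately show False using stuck[of u x] u x by auto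
qed

lemma blue_le_4:
  assumes v: "v \<in> B"
  shows "d v \<le> 4"
proof (rule ccontr)
  assume d5: "\<not> d v \<le> 4"
  then have ne: "N v \<noteq> {}" by (auto simp: d_def)
  obtain x where x: "x \<in> N v" and max: "\<And>z. z \<in> N v \<Longrightarrow> card (out v z) \<le> card (out v x)"
    using max_out[OF ne] by blast
  let ?k = "card (out v x)"
  have "bw (d v) + 70 + 0 * (int (e x) - 1) + (int (d v) - 1) * g ?k + int ?k * 17 \<le> gain v x"
  proof (rule gain_blue_const[OF v x slope0])
    show "g ?k \<le> g (dp v x z) + 0 * (int (e z) - 1)" if "z \<in> N v" for z
      using dp_le_out[OF x, of z] v max[OF that] g_anti[of "dp v x z" ?k] by simp
    show "17 \<le> g (dp v x y) + 0 * int (e y)" if "y \<in> out v x" for y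
      using dp_out_less[OF x that] white_le_4[OF out_W[OF that]] g_ge(4)[of "dp v x y"] by simp
  qed
  moreover have "4 * g ?k \<le> (int (d v) - 1) * g ?k"
    using d5 g_ge14[of ?k] by (intro mult_right_mono) auto
  \<comment> \<open>The ends bring 56 + 70, so 112 is missing. White degrees at most 4 have raised
    the outer share from 14 to 17; the minimum is 114, at \<open>?k = 2\<close>.\<close>
  moreover have "112 \<le> 4 * g ?k + int ?k * 17"
  proof -
    consider "?k = 0" | "?k = 1" | "?k = 2" | "?k = 3" | "4 \<le> ?k" by linarith
    then show ?thesis by cases (auto simp: g_simps)
  qed
  ultimately show False using stuck[of v x] v x d5 by (auto simp: bw_simps)
qed

lemma slope3: "slope 3 v x"
  unfolding slope_def dp_eq using blue_le_4 inter_le by (auto intro: bw_slope3)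

section \<open>White degrees at most 2\<close>

text \<open>\<open>3 * g k + 17 * k\<close> falls below the missing 98 = 238 - 140 only for
  \<open>k = 2\<close>.\<close>

lemma white4_out:
  assumes u: "u \<in> W" and d4: "d u = 4"
  obtains x where "x \<in> N u" "card (out u x) = 2" "\<And>z. z \<in> N u \<Longrightarrow> card (out u z) \<le> 2"
proof -
  have ne: "N u \<noteq> {}" using d4 by (auto simp: d_def)
  obtain x where x: "x \<in> N u" and max: "\<And>z. z \<in> N u \<Longrightarrow> card (out u z) \<le> card (out u x)"
    using max_out[OF ne] by blast
  let ?k = "card (out u x)"
  have "140 + 0 * int (e u) + 0 * int (e x) + (int (d u) - 1) * g ?k + int ?k * 17 \<le> gain u x"
  proof (rule gain_white_const[OF u x slope0])
    show "g ?k \<le> g (dp u x z) + 0 * int (e z)" if "z \<in> N u" for z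
      using dp_le_out[OF x, of z] u max[OF that] g_anti[of "dp u x z" ?k] by simp
    show "17 \<le> g (dp u x y) + 0 * int (e y)" if "y \<in> out u x" for y
      using dp_out_less[OF x that] white_le_4[OF out_W[OF that]] g_ge(4)[of "dp u x y"] by simp
  qed
  then have "3 * g ?k + 17 * int ?k < 98" using d4 stuck[of u x] u x by auto
  moreover have "?k < 4" using card_out_less[OF x u] white_le_4[OF in_N_W[OF x]] by simp
  moreover have "?k \<noteq> 0" "?k \<noteq> 1" "?k \<noteq> 3" using calculation(1) by (auto simp: g_simps)
  ultimately have "?k = 2" by presburger
  then show thesis using that x max by auto
qed

text \<open>The estimate behind \<open>white4_out\<close> gives 140 + 60 + 34 = 234, four short. A
  blue neighbour of \<open>x\<close> adds 3, and the last unit comes from the edges inside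
  \<open>N u\<close>.\<close>

lemma white_le_3:
  assumes u: "u \<in> W"
  shows "d u \<le> 3"
proof (rule ccontr)
  assume "\<not> d u \<le> 3"
  then have d4: "d u = 4" using white_le_4[OF u] by simp
  obtain x where x: "x \<in> N u" and k: "card (out u x) = 2"
    and max: "\<And>z. z \<in> N u \<Longrightarrow> card (out u z) \<le> 2"
    using white4_out[OF u d4] by blast
  note no_gain = stuck[OF UnI1[OF u] x]
  have xW: "x \<in> W" using x by (rule in_N_W)
  have Z20: "20 \<le> g (dp u x z) + 3 * int (e z)" if "z \<in> N u" for z
    using dp_le_out[OF x, of z] u max[OF that] g_ge(3)[of "dp u x z"] by simp
  have Y17: "17 \<le> g (dp u x y)" if "y \<in> out u x" for y
    using dp_out_less[OF x that] white_le_4[OF out_W[OF that]] g_ge(4)[of "dp u x y"] by simp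
  have dx: "d x = 3"
  proof (rule ccontr)
    assume "d x \<noteq> 3"
    then have dx4: "d x = 4" using white_le_4[OF xW] card_out_less[OF x u] k by simp
    have "20 \<le> g (dp u x y) + 3 * int (e y)" if y: "y \<in> out u x" for y
    proof -
      have yW: "y \<in> W" using y by (rule out_W)
      \<comment> \<open>Otherwise \<open>y\<close> loses only \<open>x\<close>, and by
        \<open>card_out_lone\<close> the vertex \<open>x\<close> has three outer neighbours as seen
        from \<open>y\<close>, against the bound 2.\<close>
      have "dp u x y \<le> 2"
      proof (rule ccontr)
        assume "\<not> dp u x y \<le> 2"
        then have *: "d y = 4" "d y \<le> dp u x y + 1"
          using dp_out_less[OF x y] white_le_4[OF yW] by auto
        have "x \<in> N y" using y xW by (auto simp: out_def intro: N_sym)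
        then have "card (out y x) \<le> 2" using white4_out[OF yW *(1)] by metis
        then show False using card_out_lone[OF x y *(2)] dx4 by simp
      qed
      then show ?thesis using g_ge(3)[of "dp u x y"] by simp
    qed
    from gain_white_const[OF u x slope3 Z20 this] no_gain show False using d4 k by simp
  qed
  have ex: "1 \<le> e x" using d_e[OF xW] dx by simp
  have sumY: "34 \<le> (\<Sum>y\<in>out u x. g (dp u x y) + 3 * int (e y))"
  proof -
    have "17 \<le> g (dp u x y) + 3 * int (e y)" if "y \<in> out u x" for y using Y17[OF that] by simp
    from sum_ge_const[of "out u x", OF this] show ?thesis by (simp add: k)
  qed
  \<comment> \<open>Now 140 + 3 + 60 + 34 = 237, so one neighbour that brings 21 instead of 20
    suffices.\<close>
  have special: False if a: "a \<in> N u - {x}" and "21 \<le> g (dp u x a) + 3 * int (e a)" for a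
  proof -
    have "21 + (int (card (N u - {x})) - 1) * 20 \<le> (\<Sum>z\<in>N u - {x}. g (dp u x z) + 3 * int (e z))"
      by (rule sum_ge_special[OF _ a]) (use that Z20 in auto)
    then have "61 \<le> (\<Sum>z\<in>N u - {x}. g (dp u x z) + 3 * int (e z))"
      using d4 unfolding card_N_minus[OF x] by simp
    from gain_white[OF u x slope3 this sumY] no_gain ex show False by simp
  qed
  \<comment> \<open>The three white neighbours of \<open>x\<close> are \<open>u\<close> and two
    outer ones.\<close>
  have Nxu: "N x \<inter> N u = {}"
  proof -
    have "N x = insert u (out u x) \<union> (N x \<inter> N u)" using N_sym[OF x u] by (auto simp: out_def)
    moreover have "card (insert u (out u x) \<union> (N x \<inter> N u)) = card (insert u (out u x)) + card (N x \<inter> N u)"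
      by (rule card_Un_disjoint) (auto simp: out_def)
    ultimately have "card (N x) = card (insert u (out u x)) + card (N x \<inter> N u)" by metis
    moreover have "u \<notin> out u x" by (simp add: out_def)
    ultimately show ?thesis using dx k by (simp add: d_def)
  qed
  \<comment> \<open>A blue neighbour of \<open>a\<close> would give a surplus of 3. So
    \<open>a\<close> has four white neighbours: \<open>u\<close>, at most two outer ones, and hence
    one in \<open>N u\<close>.\<close>
  have inner: "\<exists>b\<in>N u - {x}. E a b" if a: "a \<in> N u - {x}" for a
  proof -
    have aW: "a \<in> W" using a in_N_W by auto
    have out2: "card (out u a) \<le> 2" using max a by blast
    have d4a: "d a = 4"
    proof (rule ccontr)
      assume "d a \<noteq> 4"
      then have "1 \<le> e a" using d_e[OF aW] white_le_4[OF aW] by simp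
      moreover have "20 \<le> g (dp u x a)"
        using dp_le_out[OF x, of a] u out2 g_ge(3)[of "dp u x a"] by simp
      ultimately show False using special[OF a] by simp
    qed
    have "\<not> N a \<subseteq> insert u (out u a)"
    proof
      assume "N a \<subseteq> insert u (out u a)"
      then have "card (N a) \<le> card (insert u (out u a))" by (intro card_mono) auto
      also have "\<dots> \<le> 3" using out2 by (simp add: card_insert_if)
      finally show False using d4a by (simp add: d_def)
    qed
    then obtain b where b: "b \<in> N a" "b \<in> N u" by (auto simp: out_def)
    moreover have "b \<noteq> x" using b a Nxu N_sym[of b a] aW by auto
    ultimately show ?thesis by (auto simp: N_def)
  qed
  have "card (N u - {x}) = 3" using d4 card_N_minus[OF x] by simp
  then obtain a b c where abc: "a \<in> N u - {x}" "b \<in> N u - {x}" "c \<in> N u - {x}" "b \<noteq> c" "E a b" "E a c"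
    using card3_two_neighbours[where R = E, OF _ sym irrefl inner] by metis
  have aW: "a \<in> W" using abc in_N_W by auto
  have "u \<in> N a" "u \<in> N x" using abc u x by (auto intro: N_sym)
  moreover have "b \<in> N a" "c \<in> N a" using abc by (auto simp: N_def)
  \<comment> \<open>Losing three of at most four white neighbours raises the share of
    \<open>a\<close> from 20 to at least 28.\<close>
  ultimately have "{u, b, c} \<subseteq> N a \<inter> cov u x" using abc by (auto simp: cov_def)
  moreover have "b \<noteq> u" "c \<noteq> u" using abc(2,3) self_notin_N by blast+
  then have "card {u, b, c} = 3" using abc(4) by auto
  ultimately have "3 \<le> card (N a \<inter> cov u x)" by (metis card_mono finN finite_Int)
  then have "dp u x a \<le> 1" using white_le_4[OF aW] by (simp add: dp_eq)
  then show False using special[OF abc(1)] g_ge(2)[of "dp u x a"] by simp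
qed

lemma white_e_ge: "x \<in> W \<Longrightarrow> d x \<le> m \<Longrightarrow> 4 - int m \<le> int (e x)"
  using d_e[of x] by linarith

text \<open>White vertices now have a blue neighbour, so two outer vertices would give 140 + 2 * 3 +
  4 * 23 = 238 with 23 = \<open>g 2\<close> + 3.\<close>

lemma white3_out:
  assumes u: "u \<in> W" and d3: "d u = 3" and z: "z \<in> N u"
  shows "card (out u z) \<le> 1"
proof -
  have ne: "N u \<noteq> {}" using z by auto
  obtain x where x: "x \<in> N u" and max: "\<And>z. z \<in> N u \<Longrightarrow> card (out u z) \<le> card (out u x)"
    using max_out[OF ne] by blast
  let ?k = "card (out u x)"
  have k2: "?k \<le> 2" using card_out_less[OF x u] white_le_3[OF in_N_W[OF x]] by simp
  have "?k \<noteq> 2"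
  proof
    assume k: "?k = 2"
    have "23 \<le> g (dp u x z) + 3 * int (e z)" if "z \<in> N u" for z
      using dp_le_out[OF x, of z] u max[OF that] k g_ge(3)[of "dp u x z"]
        white_e_ge[OF in_N_W[OF that] white_le_3[OF in_N_W[OF that]]] by simp
    moreover have "23 \<le> g (dp u x y) + 3 * int (e y)" if "y \<in> out u x" for y
      using dp_out_less[OF x that] white_le_3[OF out_W[OF that]] g_ge(3)[of "dp u x y"]
        white_e_ge[OF out_W[OF that] white_le_3[OF out_W[OF that]]] by simp
    ultimately have "140 + 3 * int (e u) + 3 * int (e x) + (int (d u) - 1) * 23 + int ?k * 23 \<le> gain u x"
      by (rule gain_white_const[OF u x slope3])
    then show False
      using stuck[OF UnI1[OF u] x] k d3 white_e_ge[OF u white_le_3[OF u]]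
        white_e_ge[OF in_N_W[OF x] white_le_3[OF in_N_W[OF x]]] by simp
  qed
  then show ?thesis using k2 max[OF z] by linarith
qed

text \<open>If \<open>d x = 3\<close>, either the outer vertex \<open>y\<close> keeps at most one
  white neighbour, giving 140 + 6 + 3 * 31 = 239, or it loses only \<open>x\<close> and
  \<open>card_out_lone\<close> contradicts \<open>white3_out\<close> at \<open>y\<close>.\<close>

lemma white3_nbr:
  assumes u: "u \<in> W" and d3: "d u = 3" and x: "x \<in> N u" and k: "card (out u x) = 1"
  shows "d x \<le> 2"
proof (rule ccontr)
  assume "\<not> d x \<le> 2"
  have xW: "x \<in> W" using x by (rule in_N_W)
  then have dx: "d x = 3" using \<open>\<not> d x \<le> 2\<close> white_le_3 by force
  obtain y where y: "out u x = {y}" using k by (auto simp: card_1_singleton_iff)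
  then have yo: "y \<in> out u x" by simp
  have yW: "y \<in> W" using yo by (rule out_W)
  show False
  proof (cases "dp u x y \<le> 1")
    case True
    have "31 \<le> g (dp u x z) + 3 * int (e z)" if "z \<in> N u" for z
      using dp_le_out[OF x, of z] u white3_out[OF u d3 that] g_ge(2)[of "dp u x z"]
        white_e_ge[OF in_N_W[OF that] white_le_3[OF in_N_W[OF that]]] by simp
    moreover have "31 \<le> g (dp u x w) + 3 * int (e w)" if "w \<in> out u x" for w
      using that y True g_ge(2)[of "dp u x w"] white_e_ge[OF yW white_le_3[OF yW]] by simp
    ultimately have "140 + 3 * int (e u) + 3 * int (e x) + (int (d u) - 1) * 31 + int (card (out u x)) * 31 \<le> gain u x"
      by (rule gain_white_const[OF u x slope3])
    then show False
      using stuck[OF UnI1[OF u] x] k d3 white_e_ge[OF u white_le_3[OF u]]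
        white_e_ge[OF xW white_le_3[OF xW]] by simp
  next
    case False
    then have dy: "d y = 3" "d y \<le> dp u x y + 1"
      using dp_out_less[OF x yo] white_le_3[OF yW] by auto
    have "x \<in> N y" using yo xW by (auto simp: out_def intro: N_sym)
    then show False
      using card_out_lone[OF x yo dy(2)] dx white3_out[OF yW dy(1)] by fastforce
  qed
qed

text \<open>Every neighbour of \<open>u\<close> must have exactly one outer vertex; then
  \<open>white3_nbr\<close> provides two blue neighbours for each, and the total is 140 + 3 + 6 + 2
  * 34 + 23 = 240.\<close>

lemma white_le_2:
  assumes u: "u \<in> W"
  shows "d u \<le> 2"
proof (rule ccontr)
  assume "\<not> d u \<le> 2"
  then have d3: "d u = 3" using white_le_3[OF u] by simp
  then have ne: "N u \<noteq> {}" by (auto simp: d_def)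
  obtain x where x: "x \<in> N u" and max: "\<And>z. z \<in> N u \<Longrightarrow> card (out u z) \<le> card (out u x)"
    using max_out[OF ne] by blast
  note no_gain = stuck[OF UnI1[OF u] x]
  have eu: "1 \<le> int (e u)" using white_e_ge[OF u white_le_3[OF u]] by simp
  have "card (out u x) \<noteq> 0"
  proof
    assume k: "card (out u x) = 0"
    have "70 \<le> g (dp u x z) + 0 * int (e z)" if "z \<in> N u" for z
      using dp_le_out[OF x, of z] u max[OF that] k g_ge(1)[of "dp u x z"] by simp
    moreover have "70 \<le> g (dp u x y) + 0 * int (e y)" if "y \<in> out u x" for y
      using k that by simp
    ultimately have "140 + 0 * int (e u) + 0 * int (e x) + (int (d u) - 1) * 70 + int (card (out u x)) * 70 \<le> gain u x"
      by (rule gain_white_const[OF u x slope0])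
    then show False using no_gain k d3 by simp
  qed
  then have k: "card (out u x) = 1" using white3_out[OF u d3 x] by linarith
  have Y: "23 \<le> g (dp u x y) + 3 * int (e y)" if "y \<in> out u x" for y
    using dp_out_less[OF x that] white_le_3[OF out_W[OF that]] g_ge(3)[of "dp u x y"]
      white_e_ge[OF out_W[OF that] white_le_3[OF out_W[OF that]]] by simp
  have e2: "2 \<le> int (e z)" if "z \<in> N u" "card (out u z) = 1" for z
    using white_e_ge[OF in_N_W white3_nbr[OF u d3]] that by force
  \<comment> \<open>A neighbour without outer vertices brings 70: 140 + 70 + 28 = 238.\<close>
  have k1: "card (out u z) = 1" if z: "z \<in> N u" for z
  proof (rule ccontr)
    assume "card (out u z) \<noteq> 1"
    then have z0: "card (out u z) = 0" using white3_out[OF u d3 z] by linarith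
    have "70 + (int (card (N u - {x})) - 1) * 28 \<le> (\<Sum>z\<in>N u - {x}. g (dp u x z) + 0 * int (e z))"
    proof (rule sum_ge_special)
      show "z \<in> N u - {x}" using z z0 k by auto
      show "70 \<le> g (dp u x z) + 0 * int (e z)"
        using dp_le_out[OF x, of z] u z0 g_ge(1)[of "dp u x z"] by simp
      show "28 \<le> g (dp u x w) + 0 * int (e w)" if "w \<in> N u - {x}" for w
        using dp_le_out[OF x, of w] u white3_out[OF u d3, of w] that g_ge(2)[of "dp u x w"] by simp
    qed simp
    moreover have "0 \<le> (\<Sum>y\<in>out u x. g (dp u x y) + 0 * int (e y))"
      by (rule sum_nonneg) (use g_ge14 in \<open>force intro: order_trans[of 0 14]\<close>)
    ultimately have "140 + 0 * int (e u) + 0 * int (e x) + (70 + (int (card (N u - {x})) - 1) * 28) + 0 \<le> gain u x"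
      by (rule gain_white[OF u x slope0])
    then show False using no_gain d3 unfolding card_N_minus[OF x] by simp
  qed
  have Z: "34 \<le> g (dp u x z) + 3 * int (e z)" if "z \<in> N u" for z
    using dp_le_out[OF x, of z] u k1[OF that] g_ge(2)[of "dp u x z"] e2[OF that k1[OF that]] by simp
  show False
    using gain_white_const[OF u x slope3 Z Y] no_gain k d3 eu e2[OF x k] by simp
qed

section \<open>Blue degrees at most 2\<close>

text \<open>The ends bring 56 + 70, and \<open>3 * g k + 28 * k\<close> is at least the missing 112,
  with equality at \<open>k = 1\<close>.\<close>

lemma blue_le_3:
  assumes v: "v \<in> B"
  shows "d v \<le> 3"
proof (rule ccontr)
  assume "\<not> d v \<le> 3"
  then have d4: "d v = 4" using blue_le_4[OF v] by simp
  then have ne: "N v \<noteq> {}" by (auto simp: d_def)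
  obtain x where x: "x \<in> N v" and max: "\<And>z. z \<in> N v \<Longrightarrow> card (out v z) \<le> card (out v x)"
    using max_out[OF ne] by blast
  let ?k = "card (out v x)"
  have "bw (d v) + 70 + 0 * (int (e x) - 1) + (int (d v) - 1) * g ?k + int ?k * 28 \<le> gain v x"
  proof (rule gain_blue_const[OF v x slope0])
    show "g ?k \<le> g (dp v x z) + 0 * (int (e z) - 1)" if "z \<in> N v" for z
      using dp_le_out[OF x, of z] v max[OF that] g_anti[of "dp v x z" ?k] by simp
    show "28 \<le> g (dp v x y) + 0 * int (e y)" if "y \<in> out v x" for y
      using dp_out_less[OF x that] white_le_2[OF out_W[OF that]] g_ge(2)[of "dp v x y"] by simp
  qed
  then have low: "3 * g ?k + 28 * int ?k < 112" using stuck[OF UnI2[OF v] x] d4 by (simp add: bw_simps)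
  have "?k \<le> 2" using card_out_le[of v x] white_le_2[OF in_N_W[OF x]] by simp
  then consider "?k = 0" | "?k = 1" | "?k = 2" by linarith
  then show False using low by cases (simp_all add: g_simps)
qed

text \<open>The ends bring 53 + 70, so 115 is missing. A maximum of two outer vertices gives 3 + 2 *
  23 + 2 * 34 = 117, of none 140; a maximum of one with some \<open>z\<close> having none gives 70 +
  28 + 28 = 126.\<close>

lemma blue3_out:
  assumes v: "v \<in> B" and d3: "d v = 3" and z: "z \<in> N v"
  shows "card (out v z) = 1"
proof -
  have ne: "N v \<noteq> {}" using z by auto
  obtain x where x: "x \<in> N v" and max: "\<And>z. z \<in> N v \<Longrightarrow> card (out v z) \<le> card (out v x)"
    using max_out[OF ne] by blast
  note no_gain = stuck[OF UnI2[OF v] x]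
  have Y0: "28 \<le> g (dp v x y)" if "y \<in> out v x" for y
    using dp_out_less[OF x that] white_le_2[OF out_W[OF that]] g_ge(2)[of "dp v x y"] by simp
  have e2: "2 \<le> int (e w)" if "w \<in> W" for w using white_e_ge[OF that white_le_2[OF that]] by simp
  let ?k = "card (out v x)"
  have "?k \<noteq> 2"
  proof
    assume k: "?k = 2"
    have "23 \<le> g (dp v x z) + 3 * (int (e z) - 1)" if "z \<in> N v" for z
      using dp_le_out[OF x, of z] v max[OF that] k g_ge(3)[of "dp v x z"] e2[OF in_N_W[OF that]] by simp
    moreover have "34 \<le> g (dp v x y) + 3 * int (e y)" if "y \<in> out v x" for y
      using Y0[OF that] e2[OF out_W[OF that]] by simp
    ultimately have "bw (d v) + 70 + 3 * (int (e x) - 1) + (int (d v) - 1) * 23 + int ?k * 34 \<le> gain v x"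
      by (rule gain_blue_const[OF v x slope3])
    then show False using no_gain k d3 e2[OF in_N_W[OF x]] by (simp add: bw_simps)
  qed
  moreover have "?k \<noteq> 0"
  proof
    assume k: "?k = 0"
    have "70 \<le> g (dp v x z) + 0 * (int (e z) - 1)" if "z \<in> N v" for z
      using dp_le_out[OF x, of z] v max[OF that] k g_ge(1)[of "dp v x z"] by simp
    moreover have "0 \<le> g (dp v x y) + 0 * int (e y)" if "y \<in> out v x" for y
      using Y0[OF that] by simp
    ultimately have "bw (d v) + 70 + 0 * (int (e x) - 1) + (int (d v) - 1) * 70 + int ?k * 0 \<le> gain v x"
      by (rule gain_blue_const[OF v x slope0])
    then show False using no_gain d3 by (simp add: bw_simps)
  qed
  moreover have "?k \<le> 2" using card_out_le[of v x] white_le_2[OF in_N_W[OF x]] by simp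
  ultimately have k: "?k = 1" by linarith
  show ?thesis
  proof (rule ccontr)
    assume "card (out v z) \<noteq> 1"
    then have z0: "card (out v z) = 0" using max[OF z] k by linarith
    have "70 + (int (card (N v - {x})) - 1) * 28 \<le> (\<Sum>z\<in>N v - {x}. g (dp v x z) + 0 * (int (e z) - 1))"
    proof (rule sum_ge_special)
      show "z \<in> N v - {x}" using z z0 k by auto
      show "70 \<le> g (dp v x z) + 0 * (int (e z) - 1)"
        using dp_le_out[OF x, of z] v z0 g_ge(1)[of "dp v x z"] by simp
      show "28 \<le> g (dp v x w) + 0 * (int (e w) - 1)" if "w \<in> N v - {x}" for w
        using dp_le_out[OF x, of w] v max[of w] k that g_ge(2)[of "dp v x w"] by simp
    qed simp
    moreover have "int ?k * 28 \<le> (\<Sum>y\<in>out v x. g (dp v x y) + 0 * int (e y))"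
      by (rule sum_ge_const) (simp add: Y0)
    ultimately have "bw (d v) + 70 + 0 * (int (e x) - 1) + (70 + (int (card (N v - {x})) - 1) * 28) + int ?k * 28 \<le> gain v x"
      by (rule gain_blue[OF v x slope0])
    then show False using no_gain d3 k unfolding card_N_minus[OF x] by (simp add: bw_simps)
  qed
qed

text \<open>If \<open>y\<close> kept no white neighbour it would bring 70, for a total of 123 + 2 *
  28 + 70 = 249.\<close>

lemma blue3_outer:
  assumes v: "v \<in> B" and d3: "d v = 3" and x: "x \<in> N v" and y: "y \<in> out v x"
  shows "d y = 2" "dp v x y = 1"
proof -
  have Y: "out v x = {y}" using blue3_out[OF v d3 x] y by (auto simp: card_1_singleton_iff)
  have "dp v x y \<noteq> 0"
  proof
    assume 0: "dp v x y = 0"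
    have "28 \<le> g (dp v x z) + 0 * (int (e z) - 1)" if "z \<in> N v" for z
      using dp_le_out[OF x, of z] v blue3_out[OF v d3 that] g_ge(2)[of "dp v x z"] by simp
    moreover have "70 \<le> g (dp v x w) + 0 * int (e w)" if "w \<in> out v x" for w
      using that 0 Y by (simp add: g_simps)
    ultimately have "bw (d v) + 70 + 0 * (int (e x) - 1) + (int (d v) - 1) * 28 + int (card (out v x)) * 70 \<le> gain v x"
      by (rule gain_blue_const[OF v x slope0])
    then show False using stuck[OF UnI2[OF v] x] d3 Y by (simp add: bw_simps)
  qed
  then show "d y = 2" "dp v x y = 1"
    using dp_out_less[OF x y] white_le_2[OF out_W[OF y]] by auto
qed

text \<open>Some \<open>x0\<close> in \<open>N v\<close> has a single white neighbour
  \<open>y0\<close>, which has one more, \<open>y'\<close>. Choosing \<open>y0\<close> leaves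
  \<open>x0\<close> without white neighbours, worth 70; its partner is \<open>y'\<close> or a blue
  vertex.\<close>

lemma blue_le_2:
  assumes v: "v \<in> B"
  shows "d v \<le> 2"
proof (rule ccontr)
  assume "\<not> d v \<le> 2"
  then have d3: "d v = 3" using blue_le_3[OF v] by simp
  have vW: "v \<notin> W" using v disj by auto
  \<comment> \<open>Otherwise some \<open>a\<close> has two neighbours in \<open>N v\<close> besides
    its outer one, hence white degree 3.\<close>
  have "\<exists>x0\<in>N v. \<forall>b\<in>N v. \<not> E x0 b"
  proof (rule ccontr)
    assume "\<not> (\<exists>x0\<in>N v. \<forall>b\<in>N v. \<not> E x0 b)"
    then have inner: "\<And>a. a \<in> N v \<Longrightarrow> \<exists>b\<in>N v. E a b" by blast
    have "card (N v) = 3" using d3 by (simp add: d_def)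
    then obtain a b c where abc: "a \<in> N v" "b \<in> N v" "c \<in> N v" "b \<noteq> c" "E a b" "E a c"
      using card3_two_neighbours[where R = E, OF _ sym irrefl inner] by metis
    obtain y where y: "out v a = {y}" using blue3_out[OF v d3 abc(1)] by (auto simp: card_1_singleton_iff)
    have "b \<in> N a" "c \<in> N a" using abc by (auto simp: N_def)
    moreover have "y \<in> N a" "y \<notin> N v" using y by (auto simp: out_def)
    ultimately have "{b, c, y} \<subseteq> N a" by simp
    then have "card {b, c, y} \<le> d a" unfolding d_def by (intro card_mono) auto
    moreover have "y \<noteq> b" "y \<noteq> c" using \<open>y \<notin> N v\<close> abc by auto
    then have "card {b, c, y} = 3" using abc(4) by auto
    ultimately show False using white_le_2[OF in_N_W[OF abc(1)]] by simp
  qed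
  then obtain x0 where x0: "x0 \<in> N v" and lone: "\<And>b. b \<in> N v \<Longrightarrow> \<not> E x0 b" by blast
  have x0W: "x0 \<in> W" using x0 by (rule in_N_W)
  obtain y0 where y0: "out v x0 = {y0}" using blue3_out[OF v d3 x0] by (auto simp: card_1_singleton_iff)
  have Nx0: "N x0 = {y0}"
    using lone vW unfolding y0[symmetric] by (auto simp: out_def N_def)
  have y0o: "y0 \<in> out v x0" using y0 by simp
  have y0W: "y0 \<in> W" using y0o by (rule out_W)
  have dy0: "d y0 = 2" using blue3_outer[OF v d3 x0 y0o] by simp
  have "x0 \<in> N y0" using Nx0 x0W by (auto intro: N_sym)
  moreover from dy0 obtain p q where "N y0 = {p, q}" "p \<noteq> q" by (auto simp: d_def card_2_iff)
  ultimately obtain y' where Ny0: "N y0 = {x0, y'}" and y'x0: "y' \<noteq> x0" by auto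
  have y'W: "y' \<in> W" "y' \<in> N y0" using Ny0 in_N_W[of y' y0] by auto
  have y0y': "y0 \<in> N y'" "y0 \<noteq> y'" using y'W y0W N_sym by auto
  have x0y': "x0 \<notin> N y'"
  proof
    assume "x0 \<in> N y'"
    then have "y' \<in> N x0" using y'W(1) by (rule N_sym)
    then show False using Nx0 y0y'(2) by simp
  qed
  show False
  proof (cases "d y' = 2")
    case True
    \<comment> \<open>Total 140 + 70 + 28 = 238: \<open>x0\<close> keeps nothing, and the outer
      neighbour of \<open>y'\<close> keeps at most one white neighbour.\<close>
    have "N y0 - {y'} = {x0}" using Ny0 y'x0 by auto
    moreover have "dp y0 y' x0 = 0" using Nx0 y0y' by (simp add: dp_def cov_def)
    ultimately have "70 \<le> (\<Sum>z\<in>N y0 - {y'}. g (dp y0 y' z) + 0 * int (e z))"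
      by (simp add: g_simps)
    moreover have "28 \<le> (\<Sum>y\<in>out y0 y'. g (dp y0 y' y) + 0 * int (e y))"
    proof -
      have "out y0 y' = N y' - {y0}" using Ny0 x0y' by (auto simp: out_def)
      then have "card (out y0 y') = 1" using True y0y' by (simp add: d_def)
      moreover have "28 \<le> g (dp y0 y' y) + 0 * int (e y)" if "y \<in> out y0 y'" for y
        using dp_out_less[OF y'W(2) that] white_le_2[OF out_W[OF that]] g_ge(2)[of "dp y0 y' y"] by simp
      ultimately show ?thesis using sum_ge_const[of "out y0 y'" 28 "\<lambda>y. g (dp y0 y' y) + 0 * int (e y)"] by simp
    qed
    ultimately have "140 + 0 * int (e y0) + 0 * int (e y') + 70 + 28 \<le> gain y0 y'"
      by (rule gain_white[OF y0W y'W(2) slope0])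
    then show False using stuck[OF UnI1[OF y0W] y'W(2)] by simp
  next
    case False
    then have "card (N y') \<le> 1" using white_le_2[OF y'W(1)] by (simp add: d_def)
    then have Ny': "N y' = {y0}" using y0y' by (auto simp: card_le_Suc0_iff_eq)
    have "0 < e y0" using d_e[OF y0W] dy0 by simp
    then obtain u where u: "u \<in> B" "E y0 u" unfolding e_def card_gt_0_iff by auto
    txt \<open>The white component is the path x0 y0 y', and the pair u, y0 dominates all of it.\<close>
    have y0u: "y0 \<in> N u" using u y0W sym by (auto simp: N_def)
    have dpos: "1 \<le> d u" using y0u by (auto simp: d_def Suc_le_eq card_gt_0_iff)
    have bw: "42 \<le> bw (d u)" using bw_mono[OF dpos] by (simp add: bw_simps)
    have "u \<notin> W" using u disj by auto
    then have "{x0, y'} \<subseteq> cov u y0 - {u, y0}"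
      using Ny0 x0W y'W y0y' \<open>x0 \<in> N y0\<close> by (auto simp: cov_def)
    then have "(\<Sum>z\<in>{x0, y'}. g (dp u y0 z)) \<le> (\<Sum>z\<in>cov u y0 - {u, y0}. g (dp u y0 z))"
      by (intro sum_mono2) (use g_ge14 in \<open>force intro: order_trans[of 0 14]\<close>)+
    moreover have "dp u y0 x0 = 0" "dp u y0 y' = 0" using Nx0 Ny' y0u by (auto simp: dp_def cov_def)
    ultimately have "140 \<le> (\<Sum>z\<in>cov u y0 - {u, y0}. g (dp u y0 z))"
      using y'x0 by (simp add: g_simps)
    moreover have "0 \<le> (\<Sum>w\<in>B - {u}. bw (d w) - bw (dp u y0 w))"
      using drop_ge[OF slope0, of u y0] by simp
    ultimately show False
      using gain_eq[OF UnI2[OF u(1)] y0u] stuck[OF UnI2[OF u(1)] y0u] \<open>u \<notin> W\<close> bw by simp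
  qed
qed

section \<open>No white vertex remains\<close>

lemma slope8: "slope 8 v x"
  unfolding slope_def dp_eq using blue_le_2 inter_le by (auto intro: bw_slope8)

text \<open>Two blue neighbours of each white vertex are worth 16 at slope 8. The ends and these
  credits give 140 + 3 * 16, and \<open>g k + 44 * k\<close> exceeds the missing 50.\<close>

lemma white_le_1:
  assumes u: "u \<in> W"
  shows "d u \<le> 1"
proof (rule ccontr)
  assume "\<not> d u \<le> 1"
  then have d2: "d u = 2" using white_le_2[OF u] by simp
  then have ne: "N u \<noteq> {}" by (auto simp: d_def)
  obtain x where x: "x \<in> N u" and max: "\<And>z. z \<in> N u \<Longrightarrow> card (out u z) \<le> card (out u x)"
    using max_out[OF ne] by blast
  have e2: "2 \<le> int (e w)" if "w \<in> W" for w using white_e_ge[OF that white_le_2[OF that]] by simp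
  let ?k = "card (out u x)"
  have "140 + 8 * int (e u) + 8 * int (e x) + (int (d u) - 1) * (g ?k + 16) + int ?k * 44 \<le> gain u x"
  proof (rule gain_white_const[OF u x slope8])
    show "g ?k + 16 \<le> g (dp u x z) + 8 * int (e z)" if "z \<in> N u" for z
      using dp_le_out[OF x, of z] u max[OF that] g_anti[of "dp u x z" ?k] e2[OF in_N_W[OF that]] by simp
    show "44 \<le> g (dp u x y) + 8 * int (e y)" if "y \<in> out u x" for y
      using dp_out_less[OF x that] white_le_2[OF out_W[OF that]] g_ge(2)[of "dp u x y"] e2[OF out_W[OF that]] by simp
  qed
  then have low: "g ?k + int ?k * 44 < 50" using stuck[OF UnI1[OF u] x] d2 e2[OF u] e2[OF in_N_W[OF x]] by simp
  have "?k \<le> 1" using card_out_less[OF x u] white_le_2[OF in_N_W[OF x]] by simp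
  then consider "?k = 0" | "?k = 1" by linarith
  then show False using low by cases (simp_all add: g_simps)
qed

text \<open>By now \<open>p\<close> and \<open>q\<close> form an isolated white edge. A further
  white neighbour of \<open>v\<close> would make the pair \<open>v\<close>, \<open>p\<close> worth
  50 + 70 + 16 + 44 + 94 = 274.\<close>

lemma blue_within_edge:
  assumes v: "v \<in> B" and p: "p \<in> N v" and Np: "N p = {q}"
  shows "N v \<subseteq> {p, q}"
proof
  fix x' assume x': "x' \<in> N v"
  show "x' \<in> {p, q}"
  proof (rule ccontr)
    assume neq: "x' \<notin> {p, q}"
    then have "card {p, x'} \<le> d v" unfolding d_def using p x' by (intro card_mono) auto
    then have dv: "d v = 2" using neq blue_le_2[OF v] by (auto split: if_splits)
    have Nv: "N v = {p, x'}"
      by (rule card_seteq[symmetric]) (use p x' neq dv in \<open>auto simp: d_def\<close>)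
    have q: "q \<noteq> p" using Np self_notin_N[of p] by auto
    have "v \<notin> W" using v disj by auto
    then have out: "out v p = {q}" using Np Nv neq q in_N_W[of q p] by (auto simp: out_def)
    have e3: "3 \<le> int (e w)" if "w \<in> W" for w using white_e_ge[OF that white_le_1[OF that]] by simp
    have "44 \<le> g (dp v p z) + 8 * (int (e z) - 1)" if "z \<in> N v" for z
    proof -
      have "dp v p z \<le> d z" unfolding dp_def d_def by (intro card_mono) auto
      then show ?thesis using white_le_1[OF in_N_W[OF that]] g_ge(2)[of "dp v p z"] e3[OF in_N_W[OF that]] by simp
    qed
    moreover have "94 \<le> g (dp v p y) + 8 * int (e y)" if "y \<in> out v p" for y
      using dp_out_less[OF p that] white_le_1[OF out_W[OF that]] g_ge(1)[of "dp v p y"] e3[OF out_W[OF that]] by simp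
    ultimately have "bw (d v) + 70 + 8 * (int (e p) - 1) + (int (d v) - 1) * 44 + int (card (out v p)) * 94 \<le> gain v p"
      by (rule gain_blue_const[OF v p slope8])
    then show False using stuck[OF UnI2[OF v] p] dv out e3[OF in_N_W[OF p]] by (simp add: bw_simps)
  qed
qed

lemma white_isolated:
  assumes u: "u \<in> W"
  shows "N u = {}"
proof (rule ccontr)
  assume "N u \<noteq> {}"
  then obtain x where x: "x \<in> N u" by blast
  have xW: "x \<in> W" using x by (rule in_N_W)
  have ux: "u \<in> N x" using x u by (rule N_sym)
  have Nu: "N u = {x}" using white_le_1[OF u] x by (auto simp: d_def card_le_Suc0_iff_eq)
  have Nx: "N x = {u}" using white_le_1[OF xW] ux by (auto simp: d_def card_le_Suc0_iff_eq)
  have cov: "cov u x = {u, x}" using Nu Nx by (auto simp: cov_def)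
  \<comment> \<open>By \<open>blue_within_edge\<close> a blue neighbour of \<open>u\<close> or
    \<open>x\<close> loses all of its one or two white neighbours and drops from 42 or 50 to 0, at
    least 21 for each. With three blue neighbours at each end the total is 140 + 6 * 21 =
    266.\<close>
  have "slope 21 u x"
    unfolding slope_def
  proof
    fix w assume "w \<in> B - {u}"
    then have w: "w \<in> B" by simp
    show "21 * int (card (N w \<inter> cov u x)) \<le> bw (d w) - bw (dp u x w)"
    proof (cases "N w \<inter> {u, x} = {}")
      case True
      then show ?thesis by (simp add: dp_eq cov)
    next
      case False
      then have "N w \<subseteq> {u, x}" using blue_within_edge[OF w _ Nu] blue_within_edge[OF w _ Nx] by auto
      then have "N w \<inter> cov u x = N w" using cov by auto
      then have *: "card (N w \<inter> cov u x) = d w" "dp u x w = 0" by (simp_all add: d_def dp_eq)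
      consider "d w = 0" | "d w = 1" | "d w = 2" using blue_le_2[OF w] by linarith
      then show ?thesis by cases (simp_all add: * bw_simps)
    qed
  qed
  moreover have "0 \<le> (\<Sum>z\<in>N u - {x}. g (dp u x z) + 21 * int (e z))" using Nu by simp
  moreover have "out u x = {}" using Nx by (auto simp: out_def)
  then have "0 \<le> (\<Sum>y\<in>out u x. g (dp u x y) + 21 * int (e y))" by simp
  ultimately have "140 + 21 * int (e u) + 21 * int (e x) + 0 + 0 \<le> gain u x"
    by (rule gain_white[OF u x])
  then show False using stuck[OF UnI1[OF u] x]
      white_e_ge[OF u white_le_1[OF u]] white_e_ge[OF xW white_le_1[OF xW]] by simp
qed

lemma no_white: "W = {}"
proof (rule ccontr)
  assume "W \<noteq> {}"
  then obtain x0 where x0: "x0 \<in> W" by blast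
  have e4: "4 \<le> int (e w)" if "w \<in> W" for w
    using d_e[OF that] white_isolated[OF that] by (simp add: d_def)
  have out: "out v x = {}" if "x \<in> N v" for v x
    using white_isolated[OF in_N_W[OF that]] by (auto simp: out_def)
  \<comment> \<open>The 3 counts the blue neighbours other than \<open>v\<close>. The bound is tight
    twice: \<open>s = 8\<close> and degree 2 give 238, and once degree 2 is excluded,
    \<open>s = 42\<close> and degree 1 give 238.\<close>
  have bound: "bw (d v) + 70 + s * 3 + (int (d v) - 1) * (70 + s * 3) < 238"
    if v: "v \<in> B" and x: "x \<in> N v" and s: "slope s v x" and "0 \<le> s" for v x s
  proof -
    have e3: "s * 3 \<le> s * (int (e z) - 1)" if "z \<in> N v" for z
      using e4[OF in_N_W[OF that]] \<open>0 \<le> s\<close> by (intro mult_left_mono) auto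
    have "70 + s * 3 \<le> g (dp v x z) + s * (int (e z) - 1)" if "z \<in> N v" for z
      using e3[OF that] white_isolated[OF in_N_W[OF that]] by (simp add: dp_def g_simps)
    moreover have "0 \<le> g (dp v x y) + s * int (e y)" if "y \<in> out v x" for y
      using out[OF x] that by simp
    ultimately have "bw (d v) + 70 + s * (int (e x) - 1) + (int (d v) - 1) * (70 + s * 3) + int (card (out v x)) * 0 \<le> gain v x"
      by (rule gain_blue_const[OF v x s])
    then show ?thesis using stuck[OF UnI2[OF v] x] e3[OF x] by simp
  qed
  have d1: "d v \<le> 1" if v: "v \<in> B" for v
  proof (rule ccontr)
    assume "\<not> d v \<le> 1"
    then have d2: "d v = 2" using blue_le_2[OF v] by simp
    then obtain x where "x \<in> N v" by (force simp: d_def)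
    from bound[OF v this slope8] d2 show False by (simp add: bw_simps)
  qed
  have "0 < e x0" using e4[OF x0] by simp
  then obtain v where v: "v \<in> B" "E x0 v" unfolding e_def card_gt_0_iff by auto
  have x: "x0 \<in> N v" using v x0 sym by (auto simp: N_def)
  have "d v \<noteq> 0" using x by (auto simp: d_def)
  then have "d v = 1" using d1[OF v(1)] by simp
  moreover have "slope 42 v x0"
    unfolding slope_def dp_eq using d1 inter_le by (auto intro: bw_slope42)
  ultimately show False using bound[OF v(1) x, of 42] by (simp add: bw_simps)
qed

end

section \<open>Existence of a good pair and the greedy construction\<close>

context coloured_graph
begin

lemma good_pair:
  assumes "W \<noteq> {}"
  obtains v x where "v \<in> W \<union> B" "x \<in> N v" "238 \<le> gain v x"
proof (rule ccontr)
  assume *: "\<not> thesis"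
  \<comment> \<open>The negated claim is the assumption \<open>stuck\<close>.\<close>
  interpret stuck_graph W B E
    by unfold_locales (use * that not_le in blast)
  show False using no_white assms by simp
qed

end

definition white :: "'a set \<Rightarrow> ('a \<Rightarrow> 'a \<Rightarrow> bool) \<Rightarrow> 'a set \<Rightarrow> 'a set" where
  "white V E S = {v \<in> V - S. \<forall>u\<in>S. \<not> E v u}"

lemma perfect_matching_of_insert:
  assumes M: "perfect_matching_of E S M" and "E v x" "v \<notin> S" "x \<notin> S"
  shows "perfect_matching_of E (insert v (insert x S)) (insert {v, x} M)"
proof -
  have sub: "e \<subseteq> S" if "e \<in> M" for e using M that by (fastforce simp: perfect_matching_of_def)
  have "{v, x} \<inter> e = {}" "e \<inter> {v, x} = {}" if "e \<in> M" for e
    using sub[OF that] assms(3,4) by auto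
  moreover have "\<exists>a b. e = {a, b} \<and> E a b \<and> a \<in> insert v (insert x S) \<and> b \<in> insert v (insert x S)"
    if "e \<in> insert {v, x} M" for e
    using that M \<open>E v x\<close> unfolding perfect_matching_of_def by (metis insert_iff)
  ultimately show ?thesis using M unfolding perfect_matching_of_def by simp
qed

text \<open>Induction on the number of white vertices. A pair adds 2 to the cardinality and removes
  at least 238 = 2 * 119 from the weight, so the right-hand side never grows.\<close>

lemma extend_to_paired_dominating:
  fixes V :: "'a set"
  assumes G: "simple_graph V E" and deg: "\<forall>v\<in>V. degree V E v \<ge> 4"
    and "S \<subseteq> V" "perfect_matching_of E S M"
  shows "\<exists>T. paired_dominating V E T \<and>
    119 * int (card T) \<le> 119 * int (card S) + pot E (white V E S) (V - S - white V E S)"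
  using assms(3,4)
proof (induction "card (white V E S)" arbitrary: S M rule: less_induct)
  case less
  let ?W = "white V E S" let ?B = "V - S - ?W"
  have finV: "finite V" and edge: "\<And>u v. E u v \<Longrightarrow> u \<in> V \<and> v \<in> V"
    and sym: "\<And>u v. E u v \<Longrightarrow> E v u" and irr: "\<And>v. \<not> E v v"
    using G by (auto simp: simple_graph_def)
  show ?case
  proof (cases "?W = {}")
    case True
    then have "dominating V E S" using less.prems by (auto simp: dominating_def white_def)
    then have "paired_dominating V E S" using less.prems by (auto simp: paired_dominating_def)
    then show ?thesis using pot_nonneg[of E ?W ?B] by (intro exI[of _ S]) simp
  next
    case False
    interpret coloured_graph ?W ?B E
    proof
      fix x assume x: "x \<in> ?W"
      have "{y \<in> ?W \<union> ?B. E x y} = {u \<in> V. E x u}" using x by (auto simp: white_def)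
      then show "4 \<le> card {y \<in> ?W \<union> ?B. E x y}" using x deg by (auto simp: white_def degree_def)
    qed (use finV irr sym in \<open>auto simp: white_def\<close>)
    obtain v x where v: "v \<in> ?W \<union> ?B" and x: "x \<in> N v" and gain: "238 \<le> gain v x"
      using good_pair[OF False] by blast
    have xW: "x \<in> ?W" and Evx: "E v x" using x by (auto simp: N_def)
    have vS: "v \<in> V" "v \<notin> S" using v by (auto simp: white_def)
    have xS: "x \<in> V" "x \<notin> S" using xW by (auto simp: white_def)
    have "v \<noteq> x" using Evx irr by auto
    let ?S = "insert v (insert x S)" and ?M = "insert {v, x} M"
    have "white V E ?S = {y \<in> ?W. y \<noteq> v \<and> y \<noteq> x \<and> \<not> E y v \<and> \<not> E y x}"
      by (auto simp: white_def)
    moreover have "cov v x = {y \<in> ?W. E v y \<or> E x y}" by (auto simp: cov_def N_def)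
    \<comment> \<open>White ends are covered too: \<open>v\<close> and \<open>x\<close> are
      adjacent, so each is dominated by the other.\<close>
    ultimately have W': "white V E ?S = ?W - cov v x" using sym Evx by blast
    have "cov v x \<subseteq> ?W" using N_subset by (auto simp: cov_def)
    moreover have "?W \<subseteq> V - S" by (auto simp: white_def)
    ultimately have B': "V - ?S - white V E ?S = ?B \<union> cov v x - {v, x}"
      unfolding W' by auto
    have "x \<in> cov v x" using x by (simp add: cov_def)
    then have "card (white V E ?S) < card ?W"
      unfolding W' using finW xW by (intro psubset_card_mono) auto
    moreover have "?S \<subseteq> V" using vS xS less.prems by auto
    moreover have "perfect_matching_of E ?S ?M"
      using less.prems(2) Evx vS(2) xS(2) by (intro perfect_matching_of_insert)
    ultimately obtain T where T: "paired_dominating V E T"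
      "119 * int (card T) \<le> 119 * int (card ?S) + pot E (white V E ?S) (V - ?S - white V E ?S)"
      using less.hyps by blast
    have "finite S" using less.prems(1) finV finite_subset by blast
    then have "card ?S = card S + 2" using vS xS \<open>v \<noteq> x\<close> by simp
    then have "119 * int (card T) \<le> 119 * int (card S) + pot E ?W ?B"
      using T(2) gain unfolding B' unfolding W' gain_def by simp
    then show ?thesis using T(1) by blast
  qed
qed

theorem theorem1:
  fixes V :: "'a set" and E :: "'a \<Rightarrow> 'a \<Rightarrow> bool"
  assumes "simple_graph V E"
    and "\<forall>v \<in> V. degree V E v \<ge> 4"
  shows "real (gamma_pr V E) \<le> 10 / 17 * real (card V)"
proof -
  have finV: "finite V" using assms(1) by (simp add: simple_graph_def)
  have "perfect_matching_of E {} {}" by (simp add: perfect_matching_of_def)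
  then obtain T where T: "paired_dominating V E T"
    and le: "119 * int (card T) \<le> 119 * int (card ({} :: 'a set)) + pot E (white V E {}) (V - {} - white V E {})"
    using extend_to_paired_dominating[OF assms, of "{}"] by blast
  have "white V E {} = V" by (auto simp: white_def)
  \<comment> \<open>Initially all vertices are white and none blue; 70 / 119 = 10 / 17.\<close>
  then have "119 * int (card T) \<le> 70 * int (card V)" using le by (simp add: pot_def)
  then have "real (card T) \<le> 10 / 17 * real (card V)" by simp
  moreover have "finite {S. paired_dominating V E S}"
    by (rule finite_subset[of _ "Pow V"]) (auto simp: paired_dominating_def dominating_def finV)
  then have "gamma_pr V E \<le> card T" unfolding gamma_pr_def using T by (intro Min_le) auto
  ultimately show ?thesis by linarith
qed

end
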